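(* Let $a\in L^1(I)$. Then $$\Lambda_{M_1}[a,T]\cup\Lambda_{M_2}[a,T]=\Lambda_A[\tilde a,2T]\subset\Lambda_P[\tilde{\tilde a},4T],$$ $$\Lambda_N[a,T]\cup\Lambda_{M_1}[a,T]=\Lambda_N[\tilde a,2T],$$ $$\Lambda_D[a,T]\cup\Lambda_{M_2}[a,T]=\Lambda_D[\tilde a,2T],$$ $$\Lambda_N[a,T]\cup\Lambda_D[a,T]\cup\Lambda_{M_1}[a,T]\cup\Lambda_{M_2}[a,T]=\Lambda_P[\tilde{\tilde a},4T],$$ $$\Lambda_P[\tilde a,2T]=\Lambda_N[a,T]\cup\Lambda_D[a,T]\subset\Lambda_P[\tilde{\tilde a},4T],$$ and $$\Lambda_P[\tilde a,2T]\cup\Lambda_A[\tilde a,2T]=\Lambda_P[\tilde{\tilde a},4T].$$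
   Context: Fix $T>0$ and put $I=[0,T]$. For $a\in L^1(I)$, $\tilde a$ is its even extension to $[0,2T]$: $\tilde a(t)=a(t)$ on $[0,T]$, $\tilde a(t)=a(2T-t)$ on $(T,2T]$; and $\tilde{\tilde a}$ is the even extension of $\tilde a$ to $[0,4T]$: $\tilde{\tilde a}(t)=\tilde a(t)$ on $[0,2T]$, $\tilde{\tilde a}(t)=\tilde a(4T-t)$ on $(2T,4T]$. For $S>0$ and $q\in L^1(0,S)$, $\Lambda_B[q,S]$ denotes the set of $\lambda\in\mathbb{R}$ such that $u''(t)+(q(t)+\lambda)u(t)=0$ for a.e. $t\in[0,S]$ has a nontrivial solution $u\in C^1[0,S]$ with $u'$ absolutely continuous satisfying the boundary condition $B$, where: $B=P$ (periodic): $u(0)=u(S)$, $u'(0)=u'(S)$; $B=A$ (anti-periodic): $u(0)=-u(S)$, $u'(0)=-u'(S)$; $B=N$ (Neumann): $u'(0)=u'(S)=0$; $B=D$ (Dirichlet): $u(0)=u(S)=0$; $B=M_1$ (mixed): $u'(0)=u(S)=0$; $B=M_2$ (mixed): $u(0)=u'(S)=0$. *)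

theory Defs
  imports "HOL-Analysis.Analysis"
begin

text \<open>The usual epsilon-delta notion of absolute continuity of a real function
  (not the library's \<open>absolutely_continuous\<close>, which is about measures).\<close>

definition abs_continuous_on :: "real set \<Rightarrow> (real \<Rightarrow> real) \<Rightarrow> bool" where
  "abs_continuous_on J f \<longleftrightarrow>
    (\<forall>\<epsilon>>0. \<exists>\<delta>>0. \<forall>(n::nat) (x::nat \<Rightarrow> real) (y::nat \<Rightarrow> real).
      (\<forall>i<n. x i \<le> y i \<and> {x i..y i} \<subseteq> J) \<and>
      (\<forall>i<n. \<forall>j<n. i \<noteq> j \<longrightarrow> {x i<..<y i} \<inter> {x j<..<y j} = {}) \<and>
      (\<Sum>i<n. y i - x i) < \<delta>
      \<longrightarrow> (\<Sum>i<n. \<bar>f (y i) - f (x i)\<bar>) < \<epsilon>)"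

datatype boundary_condition = Periodic | Antiperiodic | Neumann | Dirichlet | Mixed1 | Mixed2

text \<open>In the next two definitions the argument \<open>v\<close> is the derivative \<open>u'\<close>.\<close>

fun satisfies_bc ::
  "boundary_condition \<Rightarrow> real \<Rightarrow> (real \<Rightarrow> real) \<Rightarrow> (real \<Rightarrow> real) \<Rightarrow> bool" where
  "satisfies_bc Periodic S u v \<longleftrightarrow> u 0 = u S \<and> v 0 = v S"
| "satisfies_bc Antiperiodic S u v \<longleftrightarrow> u 0 = - u S \<and> v 0 = - v S"
| "satisfies_bc Neumann S u v \<longleftrightarrow> v 0 = 0 \<and> v S = 0"
| "satisfies_bc Dirichlet S u v \<longleftrightarrow> u 0 = 0 \<and> u S = 0"
| "satisfies_bc Mixed1 S u v \<longleftrightarrow> v 0 = 0 \<and> u S = 0"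
| "satisfies_bc Mixed2 S u v \<longleftrightarrow> u 0 = 0 \<and> v S = 0"

text \<open>Derivatives are taken within \<open>{0..S}\<close>, hence one-sided at the end points, where
  for \<open>S > 0\<close> they are still unique; values outside \<open>{0..S}\<close> play no role.\<close>

definition hill_solution ::
  "(real \<Rightarrow> real) \<Rightarrow> real \<Rightarrow> real \<Rightarrow> (real \<Rightarrow> real) \<Rightarrow> (real \<Rightarrow> real) \<Rightarrow> bool" where
  "hill_solution q S lam u v \<longleftrightarrow>
    (\<forall>t\<in>{0..S}. (u has_real_derivative v t) (at t within {0..S})) \<and>
    continuous_on {0..S} v \<and>
    abs_continuous_on {0..S} v \<and>
    (AE t in lebesgue. t \<in> {0..S} \<longrightarrow>
      (\<exists>w. (v has_real_derivative w) (at t within {0..S}) \<and> w + (q t + lam) * u t = 0))"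

definition Lambda :: "boundary_condition \<Rightarrow> (real \<Rightarrow> real) \<Rightarrow> real \<Rightarrow> real set" where
  "Lambda B q S = {lam. \<exists>u v. hill_solution q S lam u v \<and> satisfies_bc B S u v \<and>
                       (\<exists>t\<in>{0..S}. u t \<noteq> 0)}"

text \<open>Even extension of a function on \<open>[0,S]\<close> to \<open>[0,2S]\<close>, i.e. reflection about \<open>S\<close>.\<close>

definition even_ext :: "real \<Rightarrow> (real \<Rightarrow> real) \<Rightarrow> real \<Rightarrow> real" where
  "even_ext S q t = (if t \<le> S then q t else q (2 * S - t))"

end

theory Submission
  imports Defs
begin

text \<open>
  The union of \<open>[0, S]\<close> and its mirror image about \<open>S\<close> is \<open>[0, 2 * S]\<close>, and the equation with an
  even-extended potential is invariant under the reflection \<open>t \<mapsto> 2 * S - t\<close>. A solution \<open>u\<close> on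
  \<open>[0, 2 * S]\<close> therefore splits into an even part \<open>u t + u (2 * S - t)\<close> and an odd part
  \<open>u t - u (2 * S - t)\<close>, which are again solutions, and at least one of which is nontrivial. The
  even part has vanishing derivative at \<open>S\<close>, the odd part vanishes at \<open>S\<close>, and the conditions that
  \<open>u\<close> satisfies at the two ends \<open>0\<close> and \<open>2 * S\<close> become conditions on these parts at \<open>0\<close> alone
  (\<open>hill_solution_fold\<close>). Conversely, a solution on \<open>[0, S]\<close> with \<open>u' S = 0\<close> extends evenly, and one
  with \<open>u S = 0\<close> extends oddly, to a solution on \<open>[0, 2 * S]\<close> (\<open>hill_solution_unfold\<close>). Hence each
  boundary condition on \<open>[0, 2 * S]\<close> that the reflection respects has as its spectrum the union of
  two spectra on \<open>[0, S]\<close> (\<open>Lambda_even_ext\<close>):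

  \<^item> Neumann splits into Neumann and \<open>Mixed1\<close>;
  \<^item> Dirichlet splits into \<open>Mixed2\<close> and Dirichlet;
  \<^item> periodic splits into Neumann and Dirichlet;
  \<^item> anti-periodic splits into \<open>Mixed2\<close> and \<open>Mixed1\<close>.

  Applying the periodic splitting on \<open>[0, 4 * T]\<close>, and then the Neumann and Dirichlet splittings on
  \<open>[0, 2 * T]\<close>, expresses every spectrum in the theorem through those on \<open>[0, T]\<close>.
\<close>

section \<open>Absolutely continuous functions\<close>

definition nonoverlapping :: "real set \<Rightarrow> nat \<Rightarrow> (nat \<Rightarrow> real) \<Rightarrow> (nat \<Rightarrow> real) \<Rightarrow> bool" where
  "nonoverlapping J n x y \<longleftrightarrow>
    (\<forall>i<n. x i \<le> y i \<and> {x i..y i} \<subseteq> J) \<and>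
    (\<forall>i<n. \<forall>j<n. i \<noteq> j \<longrightarrow> {x i<..<y i} \<inter> {x j<..<y j} = {})"

lemma abs_continuous_on_iff:
  "abs_continuous_on J f \<longleftrightarrow>
    (\<forall>e>0. \<exists>d>0. \<forall>n x y. nonoverlapping J n x y \<longrightarrow>
      (\<Sum>i<n. y i - x i) < d \<longrightarrow> (\<Sum>i<n. \<bar>f (y i) - f (x i)\<bar>) < e)"
  unfolding abs_continuous_on_def nonoverlapping_def by (simp only: imp_conjL conj_assoc)

lemma abs_continuous_onE:
  assumes "abs_continuous_on J f" "e > 0"
  obtains d where "d > 0"
    "\<And>n x y. nonoverlapping J n x y \<Longrightarrow> (\<Sum>i<n. y i - x i) < d \<Longrightarrow>
      (\<Sum>i<n. \<bar>f (y i) - f (x i)\<bar>) < e"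
  using assms unfolding abs_continuous_on_iff by blast

lemma abs_continuous_on_subset:
  assumes "abs_continuous_on J f" "K \<subseteq> J"
  shows "abs_continuous_on K f"
proof -
  have "nonoverlapping J n x y" if "nonoverlapping K n x y" for n x y
    using that assms(2) unfolding nonoverlapping_def by blast
  with assms(1) show ?thesis unfolding abs_continuous_on_iff by meson
qed

lemma abs_continuous_on_cong:
  assumes "abs_continuous_on J f" "\<And>t. t \<in> J \<Longrightarrow> f t = g t"
  shows "abs_continuous_on J g"
proof -
  have "(\<Sum>i<n. \<bar>g (y i) - g (x i)\<bar>) = (\<Sum>i<n. \<bar>f (y i) - f (x i)\<bar>)"
    if "nonoverlapping J n x y" for n x y
  proof (rule sum.cong)
    fix i assume "i \<in> {..<n}"
    then have "x i \<le> y i" "{x i..y i} \<subseteq> J" using that by (auto simp: nonoverlapping_def)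
    then have "x i \<in> J" "y i \<in> J" by auto
    then show "\<bar>g (y i) - g (x i)\<bar> = \<bar>f (y i) - f (x i)\<bar>" using assms(2) by simp
  qed simp
  with assms(1) show ?thesis unfolding abs_continuous_on_iff by simp
qed

lemma abs_continuous_on_cmult:
  assumes "abs_continuous_on J f"
  shows "abs_continuous_on J (\<lambda>t. c * f t)"
  unfolding abs_continuous_on_iff
proof (intro allI impI)
  fix e :: real assume "e > 0"
  then have "e / (\<bar>c\<bar> + 1) > 0" by simp
  with assms obtain d where d: "d > 0"
    "\<And>n x y. nonoverlapping J n x y \<Longrightarrow> (\<Sum>i<n. y i - x i) < d \<Longrightarrow>
      (\<Sum>i<n. \<bar>f (y i) - f (x i)\<bar>) < e / (\<bar>c\<bar> + 1)"
    using abs_continuous_onE by blast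
  have "(\<Sum>i<n. \<bar>c * f (y i) - c * f (x i)\<bar>) < e"
    if "nonoverlapping J n x y" "(\<Sum>i<n. y i - x i) < d" for n x y
  proof -
    let ?s = "\<Sum>i<n. \<bar>f (y i) - f (x i)\<bar>"
    have "(\<Sum>i<n. \<bar>c * f (y i) - c * f (x i)\<bar>) = \<bar>c\<bar> * ?s"
      by (simp add: sum_distrib_left abs_mult flip: right_diff_distrib)
    also have "\<dots> \<le> (\<bar>c\<bar> + 1) * ?s"
      by (intro mult_right_mono sum_nonneg) auto
    also have "\<dots> < e"
      using d(2)[OF that] by (simp add: pos_less_divide_eq mult.commute)
    finally show ?thesis .
  qed
  with d(1) show "\<exists>d>0. \<forall>n x y. nonoverlapping J n x y \<longrightarrow> (\<Sum>i<n. y i - x i) < d \<longrightarrow>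
      (\<Sum>i<n. \<bar>c * f (y i) - c * f (x i)\<bar>) < e" by blast
qed

lemma abs_continuous_on_add:
  assumes "abs_continuous_on J f" "abs_continuous_on J g"
  shows "abs_continuous_on J (\<lambda>t. f t + g t)"
  unfolding abs_continuous_on_iff
proof (intro allI impI)
  fix e :: real assume "e > 0"
  then have e: "e / 2 > 0" by simp
  obtain d1 where d1: "d1 > 0"
    "\<And>n x y. nonoverlapping J n x y \<Longrightarrow> (\<Sum>i<n. y i - x i) < d1 \<Longrightarrow>
      (\<Sum>i<n. \<bar>f (y i) - f (x i)\<bar>) < e / 2"
    using abs_continuous_onE[OF assms(1) e] by blast
  obtain d2 where d2: "d2 > 0"
    "\<And>n x y. nonoverlapping J n x y \<Longrightarrow> (\<Sum>i<n. y i - x i) < d2 \<Longrightarrow>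
      (\<Sum>i<n. \<bar>g (y i) - g (x i)\<bar>) < e / 2"
    using abs_continuous_onE[OF assms(2) e] by blast
  have "(\<Sum>i<n. \<bar>(f (y i) + g (y i)) - (f (x i) + g (x i))\<bar>) < e"
    if "nonoverlapping J n x y" "(\<Sum>i<n. y i - x i) < min d1 d2" for n x y
  proof -
    have "(\<Sum>i<n. \<bar>(f (y i) + g (y i)) - (f (x i) + g (x i))\<bar>)
        \<le> (\<Sum>i<n. \<bar>f (y i) - f (x i)\<bar> + \<bar>g (y i) - g (x i)\<bar>)"
      by (intro sum_mono) linarith
    also have "\<dots> < e / 2 + e / 2"
      unfolding sum.distrib using that by (intro add_strict_mono d1(2) d2(2)) auto
    finally show ?thesis by simp
  qed
  moreover have "min d1 d2 > 0" using d1(1) d2(1) by simp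
  ultimately show "\<exists>d>0. \<forall>n x y. nonoverlapping J n x y \<longrightarrow> (\<Sum>i<n. y i - x i) < d \<longrightarrow>
      (\<Sum>i<n. \<bar>(f (y i) + g (y i)) - (f (x i) + g (x i))\<bar>) < e" by blast
qed

lemma nonoverlapping_reflect:
  assumes "nonoverlapping {a..b} n x y"
  shows "nonoverlapping {c - b..c - a} n (\<lambda>i. c - y i) (\<lambda>i. c - x i)"
  unfolding nonoverlapping_def
proof (intro conjI allI impI)
  fix i j assume "i < n" "j < n" "i \<noteq> j"
  then have disj: "{x i<..<y i} \<inter> {x j<..<y j} = {}"
    using assms unfolding nonoverlapping_def by blast
  have "c - z \<in> {x k<..<y k}" if "z \<in> {c - y k<..<c - x k}" for z k
    using that by auto
  with disj show "{c - y i<..<c - x i} \<inter> {c - y j<..<c - x j} = {}" by blast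
qed (use assms in \<open>auto simp: nonoverlapping_def\<close>)

lemma abs_continuous_on_reflect:
  assumes "abs_continuous_on {c - b..c - a} f"
  shows "abs_continuous_on {a..b} (\<lambda>t. f (c - t))"
  unfolding abs_continuous_on_iff
proof (intro allI impI)
  fix e :: real assume "e > 0"
  with assms obtain d where d: "d > 0"
    "\<And>n x y. nonoverlapping {c - b..c - a} n x y \<Longrightarrow> (\<Sum>i<n. y i - x i) < d \<Longrightarrow>
      (\<Sum>i<n. \<bar>f (y i) - f (x i)\<bar>) < e"
    using abs_continuous_onE by blast
  have "(\<Sum>i<n. \<bar>f (c - y i) - f (c - x i)\<bar>) < e"
    if "nonoverlapping {a..b} n x y" "(\<Sum>i<n. y i - x i) < d" for n x y
    using d(2)[OF nonoverlapping_reflect[OF that(1)]] that(2) by (simp add: abs_minus_commute)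
  with d(1) show "\<exists>d>0. \<forall>n x y. nonoverlapping {a..b} n x y \<longrightarrow> (\<Sum>i<n. y i - x i) < d \<longrightarrow>
      (\<Sum>i<n. \<bar>f (c - y i) - f (c - x i)\<bar>) < e" by blast
qed

text \<open>
  Every interval of a test family is cut at the joint \<open>m\<close> by clamping its end points with \<open>min\<close>
  and \<open>max\<close>. An interval on one side of \<open>m\<close> contributes a degenerate interval \<open>[m, m]\<close> to the other
  side, so both clamped families keep the index set of the original one.
\<close>
lemma nonoverlapping_clamp:
  assumes "nonoverlapping {a..b} n x y" "a \<le> m" "m \<le> b"
  shows "nonoverlapping {a..m} n (\<lambda>i. min (x i) m) (\<lambda>i. min (y i) m)" (is ?left)
    and "nonoverlapping {m..b} n (\<lambda>i. max (x i) m) (\<lambda>i. max (y i) m)" (is ?right)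
proof -
  have disj: "{x i<..<y i} \<inter> {x j<..<y j} = {}" if "i < n" "j < n" "i \<noteq> j" for i j
    using assms that unfolding nonoverlapping_def by blast
  have bnd: "a \<le> x i" "x i \<le> y i" "y i \<le> b" if "i < n" for i
    using assms that by (auto simp: nonoverlapping_def)
  have min: "{min (x i) m<..<min (y i) m} \<subseteq> {x i<..<y i}"
    and max: "{max (x i) m<..<max (y i) m} \<subseteq> {x i<..<y i}" for i
    by auto
  show ?left
    unfolding nonoverlapping_def
  proof (intro conjI allI impI)
    show "{min (x i) m<..<min (y i) m} \<inter> {min (x j) m<..<min (y j) m} = {}"
      if "i < n" "j < n" "i \<noteq> j" for i j
      using disj[OF that] min[of i] min[of j] by blast
    show "min (x i) m \<le> min (y i) m" "{min (x i) m..min (y i) m} \<subseteq> {a..m}" if "i < n" for i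
      using bnd[OF that] assms(2) by auto
  qed
  show ?right
    unfolding nonoverlapping_def
  proof (intro conjI allI impI)
    show "{max (x i) m<..<max (y i) m} \<inter> {max (x j) m<..<max (y j) m} = {}"
      if "i < n" "j < n" "i \<noteq> j" for i j
      using disj[OF that] max[of i] max[of j] by blast
    show "max (x i) m \<le> max (y i) m" "{max (x i) m..max (y i) m} \<subseteq> {m..b}" if "i < n" for i
      using bnd[OF that] assms(3) by auto
  qed
qed

lemma abs_continuous_on_combine:
  assumes "abs_continuous_on {a..m} f" "abs_continuous_on {m..b} f" "a \<le> m" "m \<le> b"
  shows "abs_continuous_on {a..b} f"
  unfolding abs_continuous_on_iff
proof (intro allI impI)
  fix e :: real assume "e > 0"
  then have e: "e / 2 > 0" by simp
  obtain d1 where d1: "d1 > 0"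
    "\<And>n x y. nonoverlapping {a..m} n x y \<Longrightarrow> (\<Sum>i<n. y i - x i) < d1 \<Longrightarrow>
      (\<Sum>i<n. \<bar>f (y i) - f (x i)\<bar>) < e / 2"
    using abs_continuous_onE[OF assms(1) e] by blast
  obtain d2 where d2: "d2 > 0"
    "\<And>n x y. nonoverlapping {m..b} n x y \<Longrightarrow> (\<Sum>i<n. y i - x i) < d2 \<Longrightarrow>
      (\<Sum>i<n. \<bar>f (y i) - f (x i)\<bar>) < e / 2"
    using abs_continuous_onE[OF assms(2) e] by blast
  have "(\<Sum>i<n. \<bar>f (y i) - f (x i)\<bar>) < e"
    if fam: "nonoverlapping {a..b} n x y" and len: "(\<Sum>i<n. y i - x i) < min d1 d2" for n x y
  proof -
    have le: "x i \<le> y i" if "i < n" for i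
      using fam that unfolding nonoverlapping_def by blast
    have "(\<Sum>i<n. min (y i) m - min (x i) m) \<le> (\<Sum>i<n. y i - x i)"
      by (intro sum_mono) (use le in \<open>force simp: min_def\<close>)
    then have left: "(\<Sum>i<n. \<bar>f (min (y i) m) - f (min (x i) m)\<bar>) < e / 2"
      using len by (intro d1(2) nonoverlapping_clamp(1)[OF fam] assms) simp
    have "(\<Sum>i<n. max (y i) m - max (x i) m) \<le> (\<Sum>i<n. y i - x i)"
      by (intro sum_mono) (use le in \<open>force simp: max_def\<close>)
    then have right: "(\<Sum>i<n. \<bar>f (max (y i) m) - f (max (x i) m)\<bar>) < e / 2"
      using len by (intro d2(2) nonoverlapping_clamp(2)[OF fam] assms) simp
    have "\<bar>f (y i) - f (x i)\<bar>
        \<le> \<bar>f (min (y i) m) - f (min (x i) m)\<bar> + \<bar>f (max (y i) m) - f (max (x i) m)\<bar>"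
      if "i < n" for i
      using le[OF that] by (auto simp: min_def max_def)
    then have "(\<Sum>i<n. \<bar>f (y i) - f (x i)\<bar>)
        \<le> (\<Sum>i<n. \<bar>f (min (y i) m) - f (min (x i) m)\<bar> + \<bar>f (max (y i) m) - f (max (x i) m)\<bar>)"
      by (intro sum_mono) simp
    also have "\<dots> < e / 2 + e / 2"
      unfolding sum.distrib by (intro add_strict_mono left right)
    finally show ?thesis by simp
  qed
  moreover have "min d1 d2 > 0" using d1(1) d2(1) by simp
  ultimately show "\<exists>d>0. \<forall>n x y. nonoverlapping {a..b} n x y \<longrightarrow> (\<Sum>i<n. y i - x i) < d \<longrightarrow>
      (\<Sum>i<n. \<bar>f (y i) - f (x i)\<bar>) < e" by blast
qed

section \<open>Reflection and gluing of derivatives and null sets\<close>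

lemma has_real_derivative_reflect:
  fixes a b c :: real
  assumes "(f has_real_derivative D) (at (c - t) within {c - b..c - a})"
  shows "((\<lambda>t. f (c - t)) has_real_derivative - D) (at t within {a..b})"
proof -
  have "(\<lambda>t. c - t) ` {a..b} = {c - b..c - a}"
    by (simp add: image_diff_atLeastAtMost)
  then have "(f has_real_derivative D) (at (c - t) within (\<lambda>t. c - t) ` {a..b})"
    using assms by simp
  moreover have "((\<lambda>t. c - t) has_real_derivative - 1) (at t within {a..b})"
    by (auto intro!: derivative_eq_intros)
  ultimately have "(f \<circ> (\<lambda>t. c - t) has_real_derivative D * - 1) (at t within {a..b})"
    by (rule DERIV_image_chain)
  then show ?thesis by (simp add: o_def)
qed

lemma has_real_derivative_glue:
  fixes a m b :: real
  assumes t: "t \<in> {a..b}" and m: "a \<le> m" "m \<le> b"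
    and f: "t \<in> {a..m} \<Longrightarrow> (f has_real_derivative D) (at t within {a..m})"
    and g: "t \<in> {m..b} \<Longrightarrow> (g has_real_derivative D) (at t within {m..b})"
    and fg: "f m = g m"
  shows "((\<lambda>t. if t \<le> m then f t else g t) has_real_derivative D) (at t within {a..b})"
proof -
  have int: "{a..m} \<inter> {m..b} = {m}" using m by auto
  have un: "{a..b} = {a..m} \<union> {m..b}" using m by auto
  have subs: "{a..m} \<union> {m} = {a..m}" "{m..b} \<union> {m} = {m..b}" using m by auto
  have "((\<lambda>t. if t \<in> {a..m} then f t else g t) has_vector_derivative
      (if t \<in> {a..m} then D else D)) (at t within {a..b})"
    by (rule has_vector_derivative_If_within_closures[where S = "{a..m}" and T = "{m..b}"
          and f' = "\<lambda>_. D" and g' = "\<lambda>_. D"])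
      (use t f g fg int un subs in
        \<open>auto simp: closure_closed subs simp flip: has_real_derivative_iff_has_vector_derivative\<close>)
  then have "((\<lambda>t. if t \<in> {a..m} then f t else g t) has_real_derivative D) (at t within {a..b})"
    by (simp add: has_real_derivative_iff_has_vector_derivative)
  moreover have "(if t \<in> {a..m} then f t else g t) = (if t \<le> m then f t else g t)"
    if "t \<in> {a..b}" for t using that by auto
  ultimately show ?thesis
    using t by (elim has_field_derivative_transform_within[where d = 1]) auto
qed

lemma AE_lebesgue_reflect:
  fixes P :: "real \<Rightarrow> bool" and c :: real
  assumes "AE t in lebesgue. P t"
  shows "AE t in lebesgue. P (c - t)"
proof -
  obtain N where N: "{t. \<not> P t} \<subseteq> N" "negligible N"
    using assms by (auto simp: eventually_ae_filter negligible_iff_null_sets)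
  have "negligible ((\<lambda>t. c - t) ` N)"
    by (rule negligible_differentiable_image_negligible[OF _ N(2)])
      (auto intro!: derivative_intros simp: differentiable_on_def)
  moreover have "{t. \<not> P (c - t)} \<subseteq> (\<lambda>t. c - t) ` N"
  proof
    fix t assume "t \<in> {t. \<not> P (c - t)}"
    then have "c - t \<in> N" using N(1) by auto
    then show "t \<in> (\<lambda>t. c - t) ` N" by (intro image_eqI[of _ _ "c - t"]) auto
  qed
  ultimately show ?thesis
    by (auto simp: eventually_ae_filter negligible_iff_null_sets)
qed

section \<open>Operations on solutions\<close>

lemma hill_solution_linear_combination:
  assumes "hill_solution q S lam u1 v1" "hill_solution q S lam u2 v2"
  shows "hill_solution q S lam (\<lambda>t. u1 t + c * u2 t) (\<lambda>t. v1 t + c * v2 t)"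
  unfolding hill_solution_def
proof (intro conjI ballI)
  fix t assume "t \<in> {0..S}"
  then have "(u1 has_real_derivative v1 t) (at t within {0..S})"
    "(u2 has_real_derivative v2 t) (at t within {0..S})"
    using assms unfolding hill_solution_def by blast+
  then show "((\<lambda>t. u1 t + c * u2 t) has_real_derivative v1 t + c * v2 t) (at t within {0..S})"
    by (intro DERIV_add DERIV_cmult)
next
  have "continuous_on {0..S} v1" "continuous_on {0..S} v2"
    using assms unfolding hill_solution_def by blast+
  then show "continuous_on {0..S} (\<lambda>t. v1 t + c * v2 t)"
    by (intro continuous_intros)
next
  have "abs_continuous_on {0..S} v1" "abs_continuous_on {0..S} v2"
    using assms unfolding hill_solution_def by blast+
  then show "abs_continuous_on {0..S} (\<lambda>t. v1 t + c * v2 t)"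
    by (intro abs_continuous_on_add abs_continuous_on_cmult)
next
  show "AE t in lebesgue. t \<in> {0..S} \<longrightarrow>
      (\<exists>w. ((\<lambda>t. v1 t + c * v2 t) has_real_derivative w) (at t within {0..S}) \<and>
           w + (q t + lam) * (u1 t + c * u2 t) = 0)"
  proof -
    have *: "\<exists>w. ((\<lambda>t. v1 t + c * v2 t) has_real_derivative w) (at t within {0..S}) \<and>
           w + (q t + lam) * (u1 t + c * u2 t) = 0"
      if "(v1 has_real_derivative w1) (at t within {0..S})" "w1 + (q t + lam) * u1 t = 0"
        "(v2 has_real_derivative w2) (at t within {0..S})" "w2 + (q t + lam) * u2 t = 0"
      for t w1 w2
    proof (intro exI[of _ "w1 + c * w2"] conjI)
      show "((\<lambda>t. v1 t + c * v2 t) has_real_derivative w1 + c * w2) (at t within {0..S})"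
        using that(1,3) by (intro DERIV_add DERIV_cmult)
      have "w1 + c * w2 + (q t + lam) * (u1 t + c * u2 t)
          = (w1 + (q t + lam) * u1 t) + c * (w2 + (q t + lam) * u2 t)"
        by (simp add: algebra_simps)
      then show "w1 + c * w2 + (q t + lam) * (u1 t + c * u2 t) = 0"
        using that(2,4) by simp
    qed
    have "AE t in lebesgue. t \<in> {0..S} \<longrightarrow>
      (\<exists>w. (v1 has_real_derivative w) (at t within {0..S}) \<and> w + (q t + lam) * u1 t = 0)"
      "AE t in lebesgue. t \<in> {0..S} \<longrightarrow>
      (\<exists>w. (v2 has_real_derivative w) (at t within {0..S}) \<and> w + (q t + lam) * u2 t = 0)"
      using assms unfolding hill_solution_def by blast+
    then show ?thesis
      by eventually_elim (use * in blast)
  qed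
qed

lemma even_ext_symmetric: "even_ext S q (2 * S - t) = even_ext S q t"
  by (cases "t = S") (auto simp: even_ext_def)

text \<open>Reflection changes the sign of the first derivative, but preserves the second one.\<close>
lemma hill_solution_reflect:
  assumes "hill_solution (even_ext S q) (2 * S) lam u v"
  shows "hill_solution (even_ext S q) (2 * S) lam
    (\<lambda>t. u (2 * S - t)) (\<lambda>t. - v (2 * S - t))"
  unfolding hill_solution_def
proof (intro conjI ballI)
  fix t :: real assume "t \<in> {0..2 * S}"
  then have "(u has_real_derivative v (2 * S - t)) (at (2 * S - t) within {0..2 * S})"
    using assms by (simp add: hill_solution_def)
  then show "((\<lambda>t. u (2 * S - t)) has_real_derivative - v (2 * S - t)) (at t within {0..2 * S})"
    using has_real_derivative_reflect[of u "v (2 * S - t)" "2 * S" t "2 * S" 0] by simp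
next
  have "continuous_on {0..2 * S} v"
    using assms unfolding hill_solution_def by blast
  then show "continuous_on {0..2 * S} (\<lambda>t. - v (2 * S - t))"
    by (rule continuous_on_minus[OF continuous_on_compose2]) (auto intro: continuous_intros)
next
  have "abs_continuous_on {0..2 * S} (\<lambda>t. v (2 * S - t))"
    by (rule abs_continuous_on_reflect) (use assms in \<open>simp add: hill_solution_def\<close>)
  then show "abs_continuous_on {0..2 * S} (\<lambda>t. - v (2 * S - t))"
    by (auto dest: abs_continuous_on_cmult[where c = "- 1"])
next
  have "AE t in lebesgue. t \<in> {0..2 * S} \<longrightarrow> (\<exists>w. (v has_real_derivative w)
      (at t within {0..2 * S}) \<and> w + (even_ext S q t + lam) * u t = 0)"
    using assms unfolding hill_solution_def by blast
  then have "AE t in lebesgue. 2 * S - t \<in> {0..2 * S} \<longrightarrow> (\<exists>w. (v has_real_derivative w)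
      (at (2 * S - t) within {0..2 * S}) \<and>
      w + (even_ext S q (2 * S - t) + lam) * u (2 * S - t) = 0)"
    by (rule AE_lebesgue_reflect)
  then show "AE t in lebesgue. t \<in> {0..2 * S} \<longrightarrow>
      (\<exists>w. ((\<lambda>t. - v (2 * S - t)) has_real_derivative w) (at t within {0..2 * S}) \<and>
        w + (even_ext S q t + lam) * u (2 * S - t) = 0)"
  proof eventually_elim
    case (elim t)
    show ?case
    proof
      assume "t \<in> {0..2 * S}"
      with elim obtain w where w:
        "(v has_real_derivative w) (at (2 * S - t) within {0..2 * S})"
        "w + (even_ext S q t + lam) * u (2 * S - t) = 0"
        by (auto simp: even_ext_symmetric)
      have "((\<lambda>t. v (2 * S - t)) has_real_derivative - w) (at t within {0..2 * S})"
        using has_real_derivative_reflect[of v w "2 * S" t "2 * S" 0] w(1) by simp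
      then have "((\<lambda>t. - v (2 * S - t)) has_real_derivative w) (at t within {0..2 * S})"
        by (auto dest: DERIV_minus)
      with w(2) show "\<exists>w. ((\<lambda>t. - v (2 * S - t)) has_real_derivative w)
          (at t within {0..2 * S}) \<and> w + (even_ext S q t + lam) * u (2 * S - t) = 0"
        by blast
    qed
  qed
qed

lemma hill_solution_restrict:
  assumes "hill_solution (even_ext S q) (2 * S) lam u v" "S > 0"
  shows "hill_solution q S lam u v"
  unfolding hill_solution_def
proof (intro conjI ballI)
  have sub: "{0..S} \<subseteq> {0..2 * S}" using assms(2) by auto
  show "(u has_real_derivative v t) (at t within {0..S})" if "t \<in> {0..S}" for t
    using assms(1) that sub unfolding hill_solution_def
    by (meson has_field_derivative_subset subsetD)
  show "continuous_on {0..S} v"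
    using assms(1) sub unfolding hill_solution_def by (meson continuous_on_subset)
  show "abs_continuous_on {0..S} v"
    using assms(1) sub unfolding hill_solution_def by (meson abs_continuous_on_subset)
  have "AE t in lebesgue. t \<in> {0..2 * S} \<longrightarrow> (\<exists>w. (v has_real_derivative w)
      (at t within {0..2 * S}) \<and> w + (even_ext S q t + lam) * u t = 0)"
    using assms unfolding hill_solution_def by blast
  then show "AE t in lebesgue. t \<in> {0..S} \<longrightarrow>
      (\<exists>w. (v has_real_derivative w) (at t within {0..S}) \<and> w + (q t + lam) * u t = 0)"
  proof eventually_elim
    case (elim t)
    then show ?case
      using sub has_field_derivative_subset[OF _ sub] by (fastforce simp: even_ext_def)
  qed
qed

text \<open>
  For \<open>\<sigma> = 1\<close> and \<open>\<sigma> = - 1\<close> this is twice the even and the odd part of the solution about \<open>S\<close>; the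
  reflected summand solves the same equation because the potential is symmetric.
\<close>
lemma hill_solution_fold:
  assumes "hill_solution (even_ext S q) (2 * S) lam u v" "S > 0"
  shows "hill_solution q S lam
    (\<lambda>t. u t + \<sigma> * u (2 * S - t)) (\<lambda>t. v t - \<sigma> * v (2 * S - t))"
  using hill_solution_restrict[OF hill_solution_linear_combination
      [OF assms(1) hill_solution_reflect[OF assms(1)], of \<sigma>] assms(2)]
  by simp

definition parity_ext :: "real \<Rightarrow> real \<Rightarrow> (real \<Rightarrow> real) \<Rightarrow> real \<Rightarrow> real" where
  "parity_ext \<sigma> S f t = (if t \<le> S then f t else \<sigma> * f (2 * S - t))"

lemma parity_ext_simps [simp]:
  assumes "S > 0"
  shows "parity_ext \<sigma> S f 0 = f 0" "parity_ext \<sigma> S f (2 * S) = \<sigma> * f 0"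
  using assms by (auto simp: parity_ext_def)

text \<open>
  The value at \<open>t\<close> beyond \<open>S\<close> comes from the mirror point, where the slope is that at \<open>t\<close> times
  \<open>- \<sigma>\<close>: the chain rule contributes the sign and the parity contributes \<open>\<sigma>\<close>. At \<open>t = S\<close> both
  one-sided requirements apply, so an even function must have slope zero there.
\<close>
lemma has_real_derivative_parity_ext:
  assumes S: "S > 0" and t: "t \<in> {0..2 * S}"
    and left: "t \<le> S \<Longrightarrow> (f has_real_derivative D) (at t within {0..S})"
    and right: "S \<le> t \<Longrightarrow> (f has_real_derivative - \<sigma> * D) (at (2 * S - t) within {0..S})"
    and \<sigma>: "\<sigma> * \<sigma> = 1" and match: "\<sigma> * f S = f S"
  shows "(parity_ext \<sigma> S f has_real_derivative D) (at t within {0..2 * S})"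
proof -
  have "((\<lambda>t. \<sigma> * f (2 * S - t)) has_real_derivative D) (at t within {S..2 * S})" if "S \<le> t"
  proof -
    have "((\<lambda>t. f (2 * S - t)) has_real_derivative - (- \<sigma> * D)) (at t within {S..2 * S})"
      using has_real_derivative_reflect[of f "- \<sigma> * D" "2 * S" t "2 * S" S] right[OF that]
      by simp
    then have "((\<lambda>t. \<sigma> * f (2 * S - t)) has_real_derivative \<sigma> * (\<sigma> * D)) (at t within {S..2 * S})"
      by (intro DERIV_cmult) simp
    then show ?thesis
      using \<sigma> by (simp flip: mult.assoc)
  qed
  then show ?thesis
    unfolding parity_ext_def[abs_def] using S t left match
    by (intro has_real_derivative_glue) auto
qed

text \<open>
  The conditions on \<open>u S\<close> and \<open>v S\<close> say that the two halves join: for \<open>\<sigma> = 1\<close> they mean \<open>v S = 0\<close>,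
  for \<open>\<sigma> = - 1\<close> they mean \<open>u S = 0\<close>.
\<close>
lemma hill_solution_unfold:
  assumes sol: "hill_solution q S lam u v" and S: "S > 0" and \<sigma>: "\<sigma> = 1 \<or> \<sigma> = - 1"
    and u: "\<sigma> * u S = u S" and v: "- \<sigma> * v S = v S"
  shows "hill_solution (even_ext S q) (2 * S) lam (parity_ext \<sigma> S u) (parity_ext (- \<sigma>) S v)"
  unfolding hill_solution_def
proof (intro conjI ballI)
  have \<sigma>2: "\<sigma> * \<sigma> = 1" using \<sigma> by auto
  have du: "(u has_real_derivative v t) (at t within {0..S})" if "t \<in> {0..S}" for t
    using sol that unfolding hill_solution_def by blast
  show "(parity_ext \<sigma> S u has_real_derivative parity_ext (- \<sigma>) S v t) (at t within {0..2 * S})"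
    if t: "t \<in> {0..2 * S}" for t
  proof (rule has_real_derivative_parity_ext[OF S t])
    assume "t \<le> S"
    then show "(u has_real_derivative parity_ext (- \<sigma>) S v t) (at t within {0..S})"
      using du t by (simp add: parity_ext_def)
  next
    assume "S \<le> t"
    have "v (2 * S - t) = - \<sigma> * parity_ext (- \<sigma>) S v t"
      using \<open>S \<le> t\<close> v \<sigma>2 by (cases "t = S") (auto simp: parity_ext_def simp flip: mult.assoc)
    then show "(u has_real_derivative - \<sigma> * parity_ext (- \<sigma>) S v t) (at (2 * S - t) within {0..S})"
      using du[of "2 * S - t"] t \<open>S \<le> t\<close> by simp
  qed (use \<sigma>2 u in auto)
  show "continuous_on {0..2 * S} (parity_ext (- \<sigma>) S v)"
  proof -
    have cv: "continuous_on {0..S} v"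
      using sol unfolding hill_solution_def by blast
    have "continuous_on ({0..S} \<union> {S..2 * S})
        (\<lambda>t. if t \<le> S then v t else - \<sigma> * v (2 * S - t))"
    proof (rule continuous_on_cases)
      show "continuous_on {S..2 * S} (\<lambda>t. - \<sigma> * v (2 * S - t))"
        by (intro continuous_intros continuous_on_compose2[OF cv]) auto
    qed (use cv v in auto)
    moreover have "{0..S} \<union> {S..2 * S} = {0..2 * S}" using S by auto
    ultimately show ?thesis by (simp add: parity_ext_def[abs_def])
  qed
  show "abs_continuous_on {0..2 * S} (parity_ext (- \<sigma>) S v)"
  proof (rule abs_continuous_on_combine)
    have ac: "abs_continuous_on {0..S} v"
      using sol unfolding hill_solution_def by blast
    then show "abs_continuous_on {0..S} (parity_ext (- \<sigma>) S v)"
      by (rule abs_continuous_on_cong) (simp add: parity_ext_def)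
    have "abs_continuous_on {S..2 * S} (\<lambda>t. - \<sigma> * v (2 * S - t))"
      by (rule abs_continuous_on_cmult, rule abs_continuous_on_reflect) (use ac in simp)
    then show "abs_continuous_on {S..2 * S} (parity_ext (- \<sigma>) S v)"
      by (rule abs_continuous_on_cong) (use v in \<open>auto simp: parity_ext_def\<close>)
  qed (use S in auto)
  have ae: "AE t in lebesgue. t \<in> {0..S} \<longrightarrow>
      (\<exists>w. (v has_real_derivative w) (at t within {0..S}) \<and> w + (q t + lam) * u t = 0)"
    using sol unfolding hill_solution_def by blast
  (* The second derivative may jump at the joint when u is odd, so the point S is left out. *)
  have "AE t in lebesgue. t \<noteq> S"
    by (auto simp: eventually_ae_filter intro!: bexI[of _ "{S}"])
  with ae AE_lebesgue_reflect[OF ae, of "2 * S"]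
  show "AE t in lebesgue. t \<in> {0..2 * S} \<longrightarrow>
      (\<exists>w. (parity_ext (- \<sigma>) S v has_real_derivative w) (at t within {0..2 * S}) \<and>
        w + (even_ext S q t + lam) * parity_ext \<sigma> S u t = 0)"
  proof eventually_elim
    case (elim t)
    show ?case
    proof
      assume t: "t \<in> {0..2 * S}"
      show "\<exists>w. (parity_ext (- \<sigma>) S v has_real_derivative w) (at t within {0..2 * S}) \<and>
        w + (even_ext S q t + lam) * parity_ext \<sigma> S u t = 0"
      proof (cases "t < S")
        case True
        then obtain w where w: "(v has_real_derivative w) (at t within {0..S})"
          "w + (q t + lam) * u t = 0"
          using elim(1) t by auto
        have "(parity_ext (- \<sigma>) S v has_real_derivative w) (at t within {0..2 * S})"
          by (rule has_real_derivative_parity_ext[OF S t]) (use True w(1) \<sigma>2 v in auto)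
        then show ?thesis
          using w(2) True by (intro exI[of _ w]) (simp add: parity_ext_def even_ext_def)
      next
        case False
        with elim(3) have "S < t" by simp
        then obtain w where w: "(v has_real_derivative w) (at (2 * S - t) within {0..S})"
          "w + (q (2 * S - t) + lam) * u (2 * S - t) = 0"
          using elim(2) t by auto
        have "(parity_ext (- \<sigma>) S v has_real_derivative \<sigma> * w) (at t within {0..2 * S})"
          by (rule has_real_derivative_parity_ext[OF S t])
            (use \<open>S < t\<close> w(1) \<sigma>2 v in \<open>auto simp flip: mult.assoc\<close>)
        moreover have "\<sigma> * w + (even_ext S q t + lam) * parity_ext \<sigma> S u t
            = \<sigma> * (w + (q (2 * S - t) + lam) * u (2 * S - t))"
          using \<open>S < t\<close> by (simp add: parity_ext_def even_ext_def algebra_simps)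
        ultimately show ?thesis
          using w(2) by (intro exI[of _ "\<sigma> * w"]) simp
      qed
    qed
  qed
qed

section \<open>Splitting of spectra\<close>

text \<open>
  \<open>Ce\<close> is the condition that \<open>B\<close> induces on even parts, \<open>Co\<close> the one that it induces on odd parts.
\<close>
lemma Lambda_even_ext:
  assumes S: "S > 0"
    and fold_even: "\<And>u v. satisfies_bc B (2 * S) u v \<Longrightarrow>
      satisfies_bc Ce S (\<lambda>t. u t + u (2 * S - t)) (\<lambda>t. v t - v (2 * S - t))"
    and fold_odd: "\<And>u v. satisfies_bc B (2 * S) u v \<Longrightarrow>
      satisfies_bc Co S (\<lambda>t. u t - u (2 * S - t)) (\<lambda>t. v t + v (2 * S - t))"
    and unfold_even: "\<And>u v. satisfies_bc Ce S u v \<Longrightarrow>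
      v S = 0 \<and> satisfies_bc B (2 * S) (parity_ext 1 S u) (parity_ext (- 1) S v)"
    and unfold_odd: "\<And>u v. satisfies_bc Co S u v \<Longrightarrow>
      u S = 0 \<and> satisfies_bc B (2 * S) (parity_ext (- 1) S u) (parity_ext 1 S v)"
  shows "Lambda B (even_ext S q) (2 * S) = Lambda Ce q S \<union> Lambda Co q S"
proof (intro equalityI subsetI)
  fix lam assume "lam \<in> Lambda B (even_ext S q) (2 * S)"
  then obtain u v t where sol: "hill_solution (even_ext S q) (2 * S) lam u v"
    and bc: "satisfies_bc B (2 * S) u v" and t: "t \<in> {0..2 * S}" "u t \<noteq> 0"
    unfolding Lambda_def by blast
  (* The point or its mirror image lies in the half that is kept. *)
  obtain s where s: "s \<in> {0..S}" "u s \<noteq> 0 \<or> u (2 * S - s) \<noteq> 0"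
  proof (cases "t \<le> S")
    case True then show ?thesis using that[of t] t by auto
  next
    case False then show ?thesis using that[of "2 * S - t"] t by auto
  qed
  then consider "u s + u (2 * S - s) \<noteq> 0" | "u s - u (2 * S - s) \<noteq> 0" by linarith
  then show "lam \<in> Lambda Ce q S \<union> Lambda Co q S"
  proof cases
    case 1
    have "hill_solution q S lam (\<lambda>t. u t + u (2 * S - t)) (\<lambda>t. v t - v (2 * S - t))"
      using hill_solution_fold[OF sol S, of 1] by simp
    then have "lam \<in> Lambda Ce q S"
      unfolding Lambda_def using fold_even[OF bc] s(1) 1 by blast
    then show ?thesis ..
  next
    case 2
    have "hill_solution q S lam (\<lambda>t. u t - u (2 * S - t)) (\<lambda>t. v t + v (2 * S - t))"
      using hill_solution_fold[OF sol S, of "- 1"] by simp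
    then have "lam \<in> Lambda Co q S"
      unfolding Lambda_def using fold_odd[OF bc] s(1) 2 by blast
    then show ?thesis ..
  qed
next
  have mem: "lam \<in> Lambda B (even_ext S q) (2 * S)"
    if "hill_solution (even_ext S q) (2 * S) lam (parity_ext \<sigma> S u) v"
      "satisfies_bc B (2 * S) (parity_ext \<sigma> S u) v" "t \<in> {0..S}" "u t \<noteq> 0" for lam \<sigma> u v t
  proof -
    have "t \<in> {0..2 * S}" "parity_ext \<sigma> S u t \<noteq> 0"
      using that(3,4) by (auto simp: parity_ext_def)
    with that(1,2) show ?thesis unfolding Lambda_def by blast
  qed
  fix lam assume "lam \<in> Lambda Ce q S \<union> Lambda Co q S"
  then show "lam \<in> Lambda B (even_ext S q) (2 * S)"
  proof
    assume "lam \<in> Lambda Ce q S"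
    then obtain u v t where uv: "hill_solution q S lam u v" "satisfies_bc Ce S u v"
      "t \<in> {0..S}" "u t \<noteq> 0"
      unfolding Lambda_def by blast
    show ?thesis
      using hill_solution_unfold[OF uv(1) S, of 1] unfold_even[OF uv(2)] uv(3,4) by (auto intro: mem)
  next
    assume "lam \<in> Lambda Co q S"
    then obtain u v t where uv: "hill_solution q S lam u v" "satisfies_bc Co S u v"
      "t \<in> {0..S}" "u t \<noteq> 0"
      unfolding Lambda_def by blast
    show ?thesis
      using hill_solution_unfold[OF uv(1) S, of "- 1"] unfold_odd[OF uv(2)] uv(3,4)
      by (auto intro: mem)
  qed
qed

lemma
  assumes "S > 0"
  shows Lambda_Neumann_even_ext:
      "Lambda Neumann (even_ext S q) (2 * S) = Lambda Neumann q S \<union> Lambda Mixed1 q S"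
    and Lambda_Dirichlet_even_ext:
      "Lambda Dirichlet (even_ext S q) (2 * S) = Lambda Mixed2 q S \<union> Lambda Dirichlet q S"
    and Lambda_Periodic_even_ext:
      "Lambda Periodic (even_ext S q) (2 * S) = Lambda Neumann q S \<union> Lambda Dirichlet q S"
    and Lambda_Antiperiodic_even_ext:
      "Lambda Antiperiodic (even_ext S q) (2 * S) = Lambda Mixed2 q S \<union> Lambda Mixed1 q S"
  using assms by (intro Lambda_even_ext; simp)+


theorem mainTheorem6:
  fixes T :: real and a :: "real \<Rightarrow> real"
  assumes "T > 0"
    and "a absolutely_integrable_on {0..T}"
  shows
    "let a1 = even_ext T a; a2 = even_ext (2 * T) a1 in
     (Lambda Mixed1 a T \<union> Lambda Mixed2 a T = Lambda Antiperiodic a1 (2 * T) \<and>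
      Lambda Antiperiodic a1 (2 * T) \<subseteq> Lambda Periodic a2 (4 * T)) \<and>
     Lambda Neumann a T \<union> Lambda Mixed1 a T = Lambda Neumann a1 (2 * T) \<and>
     Lambda Dirichlet a T \<union> Lambda Mixed2 a T = Lambda Dirichlet a1 (2 * T) \<and>
     Lambda Neumann a T \<union> Lambda Dirichlet a T \<union> Lambda Mixed1 a T \<union> Lambda Mixed2 a T
       = Lambda Periodic a2 (4 * T) \<and>
     (Lambda Periodic a1 (2 * T) = Lambda Neumann a T \<union> Lambda Dirichlet a T \<and>
      Lambda Neumann a T \<union> Lambda Dirichlet a T \<subseteq> Lambda Periodic a2 (4 * T)) \<and>
     Lambda Periodic a1 (2 * T) \<union> Lambda Antiperiodic a1 (2 * T) = Lambda Periodic a2 (4 * T)"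
proof -
  have "4 * T = 2 * (2 * T)" "2 * T > 0" using assms(1) by simp_all
  then show ?thesis
    unfolding Let_def
    by (simp only: assms(1) Lambda_Neumann_even_ext Lambda_Dirichlet_even_ext
        Lambda_Periodic_even_ext Lambda_Antiperiodic_even_ext) blast
qed

end
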